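(* For $10/9\le R\le\frac{1+\sqrt2}{2}$, the following algorithm is $\frac{1+\sqrt{1+4R}}{2R}$-competitive for the proportional\&removable online knapsack problem with a buffer of capacity $R$. Let $r=\frac{\sqrt{1+4R}-1}{2}$ (so $r+r^2=R$). Call an item $e$ small if $s(e)\le 1-r$, medium if $1-r<s(e)<r$, large if $s(e)\ge r$; let $S$ and $M$ be the sets of small and medium items, and split $M$ into $M_1=\{e: 1-r<s(e)\le r/2\}$, $M_2=\{e: r/2<s(e)<r^2\}$, $M_3=\{e: r^2\le s(e)<r\}$. Start with $B_0=\emptyset$. In round $i$, compute sets $B_i^{(1)},B_i^{(2)}$ (with $B_i^{(2)}=\emptyset$ unless set otherwise) as follows. If there exists $B'\subseteq B_{i-1}\cup\{e_i\}$ with $r\le s(B')\le 1$, set $B_i^{(1)}=B'$ for such a $B'$. Otherwise, if $s((B_{i-1}\cup\{e_i\})\cap M)\ge r^2$: let $T_i$ be a set minimizing $s(B')$ over $B'\subseteq (B_{i-1}\cup\{e_i\})\cap M$ with $s(B')\ge r^2$; set $B_i^{(1)}=T_i\cup((B_{i-1}\cup\{e_i\})\cap S)$; and if $B_i^{(1)}\ne B_{i-1}\cup\{e_i\}$, let $a$ be an item of minimum size in $(B_{i-1}\cup\{e_i\})\setminus B_i^{(1)}$ and, if $a\in M_1\cup M_2$, set $B_i^{(2)}=\{a\}$. Otherwise set $B_i^{(1)}=B_{i-1}\cup\{e_i\}$. Finally set $B_i=B_i^{(1)}\cup B_i^{(2)}$.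
   Context: Online knapsack problem with a resource buffer: there is a knapsack of capacity $1$ and a buffer of capacity $R\ge 1$. Items $e_1,\dots,e_n$ arrive one by one; each item $e$ has size $0<s(e)\le 1$ and value $v(e)\ge 0$; $s(B),v(B)$ denote sums over a set $B$. A deterministic online algorithm maintains buffer contents $B_0=\emptyset,B_1,\dots,B_n$, with $B_i$ chosen after seeing only $e_1,\dots,e_i$, $B_i\subseteq B_{i-1}\cup\{e_i\}$ and $s(B_i)\le R$ (removable setting). $\mathrm{ALG}(I)=\max\{v(B)\mid B\subseteq B_n,\ s(B)\le 1\}$, $\mathrm{OPT}(I)=\max\{v(B)\mid B\subseteq\{e_1,\dots,e_n\},\ s(B)\le 1\}$. "Proportional" means $v(e)=s(e)$ for every item. An algorithm is $c$-competitive if $\mathrm{OPT}(I)\le c\cdot\mathrm{ALG}(I)$ for every input $I$. Ties are broken arbitrarily. *)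

theory Defs
  imports Complex_Main
begin

text \<open>
  An input is the list of the arriving items.  Two items may agree in size and value, so an item
  is identified by its position in the list (starting at 0), and a set of items is a set of
  positions.
\<close>

datatype item = Item (isize: real) (ivalue: real)

definition total :: "(item \<Rightarrow> real) \<Rightarrow> item list \<Rightarrow> nat set \<Rightarrow> real" where
  "total f I B = (\<Sum>j\<in>B. f (I ! j))"

definition knapsack_inputs :: "item list set" where
  "knapsack_inputs = {I. \<forall>e\<in>set I. 0 < isize e \<and> isize e \<le> 1 \<and> 0 \<le> ivalue e}"

definition proportional_inputs :: "item list set" where
  "proportional_inputs = {I \<in> knapsack_inputs. \<forall>e\<in>set I. ivalue e = isize e}"

definition best_value :: "item list \<Rightarrow> nat set \<Rightarrow> real" where
  "best_value I C = Max {total ivalue I B | B. B \<subseteq> C \<and> total isize I B \<le> 1}"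

definition OPT :: "item list \<Rightarrow> real" where
  "OPT I = best_value I {..<length I}"

text \<open>
  A deterministic online algorithm is a function \<open>A\<close> from the sequence of items seen so far to the
  current buffer contents; on the input \<open>I\<close> the buffer after round \<open>i\<close> is \<open>A (take i I)\<close>.
\<close>

definition ALG :: "(item list \<Rightarrow> nat set) \<Rightarrow> item list \<Rightarrow> real" where
  "ALG A I = best_value I (A I)"

definition removable_online_algorithm ::
    "item list set \<Rightarrow> real \<Rightarrow> (item list \<Rightarrow> nat set) \<Rightarrow> bool" where
  "removable_online_algorithm \<I> R A \<longleftrightarrow>
     A [] = {} \<and>
     (\<forall>I e. I @ [e] \<in> \<I> \<longrightarrow>
        A (I @ [e]) \<subseteq> A I \<union> {length I} \<and>
        total isize (I @ [e]) (A (I @ [e])) \<le> R)"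

definition competitive ::
    "item list set \<Rightarrow> real \<Rightarrow> (item list \<Rightarrow> nat set) \<Rightarrow> bool" where
  "competitive \<I> c A \<longleftrightarrow> (\<forall>I\<in>\<I>. OPT I \<le> c * ALG A I)"

definition threshold :: "real \<Rightarrow> real" where
  "threshold R = (sqrt (1 + 4 * R) - 1) / 2"

definition small_items :: "real \<Rightarrow> item list \<Rightarrow> nat set" where
  "small_items r I = {j. j < length I \<and> isize (I ! j) \<le> 1 - r}"

definition medium_items :: "real \<Rightarrow> item list \<Rightarrow> nat set" where
  "medium_items r I = {j. j < length I \<and> 1 - r < isize (I ! j) \<and> isize (I ! j) < r}"

definition medium1_items :: "real \<Rightarrow> item list \<Rightarrow> nat set" where
  "medium1_items r I = {j. j < length I \<and> 1 - r < isize (I ! j) \<and> isize (I ! j) \<le> r / 2}"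

definition medium2_items :: "real \<Rightarrow> item list \<Rightarrow> nat set" where
  "medium2_items r I = {j. j < length I \<and> r / 2 < isize (I ! j) \<and> isize (I ! j) < r\<^sup>2}"

definition good_packing :: "real \<Rightarrow> item list \<Rightarrow> nat set \<Rightarrow> nat set \<Rightarrow> bool" where
  "good_packing r I C B \<longleftrightarrow> B \<subseteq> C \<and> r \<le> total isize I B \<and> total isize I B \<le> 1"

text \<open>
  \<open>buffer_round r I C B\<close> says that \<open>B\<close> is a possible new buffer when the available items (the old
  buffer and the arriving item) are \<open>C\<close>.  It is a relation because ties are broken arbitrarily.
\<close>

definition buffer_round :: "real \<Rightarrow> item list \<Rightarrow> nat set \<Rightarrow> nat set \<Rightarrow> bool" where
  "buffer_round r I C B \<longleftrightarrow> (\<exists>B1 B2. B = B1 \<union> B2 \<and>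
     (if \<exists>B'. good_packing r I C B' then
        good_packing r I C B1 \<and> B2 = {}
      else if total isize I (C \<inter> medium_items r I) \<ge> r\<^sup>2 then
        (\<exists>T. is_arg_min (total isize I)
               (\<lambda>B'. B' \<subseteq> C \<inter> medium_items r I \<and> total isize I B' \<ge> r\<^sup>2) T \<and>
             B1 = T \<union> (C \<inter> small_items r I)) \<and>
        (if B1 \<noteq> C then
           (\<exists>a. is_arg_min (\<lambda>j. isize (I ! j)) (\<lambda>j. j \<in> C - B1) a \<and>
                B2 = (if a \<in> medium1_items r I \<union> medium2_items r I then {a} else {}))
         else B2 = {})
      else B1 = C \<and> B2 = {}))"

text \<open>
  The deterministic instances of the algorithm: each function below resolves the ties in some way,
  possibly depending on all the items seen so far.
\<close>

definition buffer_algorithm :: "real \<Rightarrow> (item list \<Rightarrow> nat set) \<Rightarrow> bool" where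
  "buffer_algorithm R A \<longleftrightarrow>
     A [] = {} \<and>
     (\<forall>I e. I @ [e] \<in> proportional_inputs \<longrightarrow>
        buffer_round (threshold R) (I @ [e]) (A I \<union> {length I}) (A (I @ [e])))"

end

theory Submission
  imports Defs
begin

text \<open>
  A packing of size between \<open>r\<close> and 1 stays available for ever and is \<open>1 / r\<close>-competitive because
  \<open>OPT \<le> 1\<close>.  As long as there is none, any packing of size at most 1 inside the buffer has size
  below \<open>r\<close>, so all small items can be added to it.  The buffer then contains all small items, a
  smallest medium item, and a set \<open>T\<close> that is smallest of size at least \<open>r\<^sup>2\<close> among the sets of all
  medium items seen so far, discarded ones included.  Since \<open>r\<^sup>2 + (1 - r) \<ge> r\<close>, a medium item
  arriving later overfills \<open>T\<close>; hence neither three medium items nor an item of \<open>M\<^sub>3\<close> together with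
  another medium item can fit into the knapsack.  A pair \<open>x, y\<close> from \<open>M\<^sub>1 \<union> M\<^sub>2\<close> has total size at
  most \<open>2 (r - p)\<close>, where \<open>p\<close> is the smallest medium size, and this is at most \<open>s(T) / r\<close>.
\<close>

section \<open>Packings, covers and buffer sizes\<close>

text \<open>The two bounds on \<open>r\<close> are those on the capacity: r = 2/3 and r = 1 / sqrt 2
  give r + r^2 = 10/9 and r + r^2 = (1 + sqrt 2) / 2.\<close>

locale buffer_sizes =
  fixes r :: real and w :: "nat \<Rightarrow> real"
  assumes r_ge: "2 / 3 \<le> r" and r_square: "2 * r\<^sup>2 \<le> 1"
    and w_pos: "\<And>j. 0 < w j"
begin

definition small :: "nat set" where "small = {j. w j \<le> 1 - r}"

definition med :: "nat set" where "med = {j. 1 - r < w j \<and> w j < r}"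

definition no_good :: "nat set \<Rightarrow> bool" where
  "no_good C \<longleftrightarrow> (\<forall>P\<subseteq>C. sum w P \<le> 1 \<longrightarrow> sum w P < r)"

text \<open>Only the competitors are confined to \<open>N\<close>, so that a set \<open>T\<close>
  found in the buffer can be compared with all medium items that have arrived.\<close>

definition min_cover :: "nat set \<Rightarrow> nat set \<Rightarrow> bool" where
  "min_cover N T \<longleftrightarrow>
     T \<subseteq> med \<and> r\<^sup>2 \<le> sum w T \<and> (\<forall>P\<subseteq>N \<inter> med. r\<^sup>2 \<le> sum w P \<longrightarrow> sum w T \<le> sum w P)"

text \<open>The branch of a round that may discard items. The candidate \<open>a\<close> is never
  small, so the test against r^2 can replace membership in M1 or M2.\<close>

definition compress :: "nat set \<Rightarrow> nat set \<Rightarrow> bool" where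
  "compress C D \<longleftrightarrow> (\<exists>T\<subseteq>C. min_cover C T \<and>
     (D = C \<and> C = T \<union> (C \<inter> small) \<or>
      (\<exists>a. is_arg_min w (\<lambda>j. j \<in> C - (T \<union> (C \<inter> small))) a \<and>
         D = T \<union> (C \<inter> small) \<union> (if w a < r\<^sup>2 then {a} else {}))))"

text \<open>A rational bound for linear arithmetic; 3/4 is the value at which three sizes of 1 - r
  just reach r.\<close>

lemma r_le: "r \<le> 3 / 4"
proof (rule ccontr)
  assume "\<not> r \<le> 3 / 4"
  then have "(3/4)\<^sup>2 < r\<^sup>2" by (intro power_strict_mono) auto
  then show False using r_square by (simp add: power2_eq_square)
qed

text \<open>The difference of the two sides is (1 - r)^2. Hence a cover and one further medium item
  always reach \<open>r\<close>.\<close>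

lemma cover_plus_medium: "r \<le> r\<^sup>2 + (1 - r)"
  using zero_le_power2[of "1 - r"] by (simp add: power2_eq_square algebra_simps)

text \<open>Puts the upper limit r/2 of M1 below r^2, so that M1 and M2 together are the items of
  size strictly between 1 - r and r^2.\<close>

lemma half_less_square: "r / 2 < r\<^sup>2"
  using mult_strict_left_mono[of "1 / 2" r r] r_ge by (simp add: power2_eq_square)

lemma sum_w_mono: "finite Q \<Longrightarrow> P \<subseteq> Q \<Longrightarrow> sum w P \<le> sum w Q"
  using w_pos by (intro sum_mono2) (auto intro: less_imp_le)

lemma w_le_sum: "finite P \<Longrightarrow> j \<in> P \<Longrightarrow> w j \<le> sum w P"
  using sum_w_mono[of P "{j}"] by simp

lemma pair_le_sum: "finite P \<Longrightarrow> i \<in> P \<Longrightarrow> j \<in> P \<Longrightarrow> i \<noteq> j \<Longrightarrow> w i + w j \<le> sum w P"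
  using sum_w_mono[of P "{i, j}"] by simp

lemma sum_med_ge: "finite P \<Longrightarrow> P \<subseteq> med \<Longrightarrow> real (card P) * (1 - r) \<le> sum w P"
  by (rule sum_bounded_below) (use med_def in fastforce)

lemma no_goodD: "no_good C \<Longrightarrow> P \<subseteq> C \<Longrightarrow> sum w P \<le> 1 \<Longrightarrow> sum w P < r"
  by (auto simp: no_good_def)

lemma no_good_big: "no_good C \<Longrightarrow> P \<subseteq> C \<Longrightarrow> r \<le> sum w P \<Longrightarrow> 1 < sum w P"
  using no_goodD not_le by blast

lemma no_good_mono: "no_good C \<Longrightarrow> D \<subseteq> C \<Longrightarrow> no_good D"
  by (auto simp: no_good_def)

text \<open>Add the small items one at a time. From below \<open>r\<close> the sum rises by at most
  1 - r, so it stays within 1, and the absence of a good packing forces it below \<open>r\<close>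
  again.\<close>

lemma sum_with_small_less:
  assumes "finite C" "no_good C" "P \<subseteq> C" "sum w P \<le> 1"
  shows "sum w (P \<union> (C \<inter> small)) < r"
proof -
  have fP: "finite P" using assms finite_subset by blast
  have "Q \<subseteq> C \<inter> small \<Longrightarrow> sum w (P \<union> Q) < r" if "finite Q" for Q
    using that
  proof (induction Q rule: finite_induct)
    case empty
    then show ?case using no_goodD[OF assms(2-4)] by simp
  next
    case (insert q Q)
    show ?case
    proof (cases "q \<in> P")
      case True
      then show ?thesis using insert by (simp add: insert_absorb)
    next
      case False
      have "sum w (P \<union> insert q Q) = w q + sum w (P \<union> Q)"
        using False insert fP by simp
      moreover have "w q \<le> 1 - r" using insert.prems by (auto simp: small_def)
      moreover have "sum w (P \<union> Q) < r" using insert by simp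
      ultimately show ?thesis
        using insert.prems assms by (intro no_goodD[OF assms(2)]) auto
    qed
  qed
  then show ?thesis using assms(1) by simp
qed

text \<open>A member of size at least r^2 is a cover by itself, so minimality bounds
  \<open>T\<close> by it. Otherwise dropping that member leaves less than r^2, and the total is
  below 2r^2.\<close>

lemma min_cover_le_1:
  assumes "finite T" "min_cover N T" "T \<subseteq> N"
  shows "sum w T \<le> 1"
proof -
  have T: "T \<subseteq> med" "r\<^sup>2 \<le> sum w T" using assms by (auto simp: min_cover_def)
  have least: "sum w T \<le> sum w P" if "P \<subseteq> T" "r\<^sup>2 \<le> sum w P" for P
  proof -
    have "P \<subseteq> N \<inter> med" using that T assms(3) by blast
    then show ?thesis using assms(2) that unfolding min_cover_def by blast
  qed
  have "T \<noteq> {}" using T r_ge by auto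
  then obtain t where t: "t \<in> T" by auto
  show ?thesis
  proof (cases "r\<^sup>2 \<le> w t")
    case True
    then have "sum w T \<le> w t" using least[of "{t}"] t by simp
    then show ?thesis using t T r_le by (force simp: med_def)
  next
    case False
    have "sum w T = w t + sum w (T - {t})" using t assms(1) by (simp add: sum.remove)
    moreover have "sum w (T - {t}) < r\<^sup>2"
      using least[of "T - {t}"] w_pos[of t] calculation by force
    ultimately show ?thesis using False r_square by linarith
  qed
qed

text \<open>An item of size at least \<open>r\<close> would be a good packing alone, so besides the
  medium items, which fit together, there are only small ones to add.\<close>

lemma sum_keep_less:
  assumes "finite C" "no_good C" "\<And>j. j \<in> C \<Longrightarrow> w j \<le> 1" "sum w (C \<inter> med) \<le> 1"
  shows "sum w C < r"
proof -
  have "w j < r" if "j \<in> C" for j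
    using no_goodD[OF assms(2), of "{j}"] assms(3) that by simp
  then have "C = C \<inter> med \<union> (C \<inter> small)" by (auto simp: med_def small_def)
  then show ?thesis using sum_with_small_less[of C "C \<inter> med"] assms by simp
qed

text \<open>The cover and the small items stay below \<open>r\<close>, and the one extra item is
  below r^2.\<close>

lemma sum_compress_le:
  assumes "finite C" "no_good C" "compress C D"
  shows "sum w D \<le> r + r\<^sup>2"
proof -
  from assms(3) obtain T where T: "T \<subseteq> C" "min_cover C T"
    and D: "D = T \<union> (C \<inter> small) \<or>
      (\<exists>a. D = T \<union> (C \<inter> small) \<union> (if w a < r\<^sup>2 then {a} else {}))"
    unfolding compress_def by metis
  have fT: "finite T" using T assms finite_subset by blast
  have B1: "sum w (T \<union> (C \<inter> small)) < r"
    using sum_with_small_less assms T min_cover_le_1[OF fT T(2,1)] by blast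
  have "sum w (T \<union> (C \<inter> small) \<union> {a}) \<le> r + r\<^sup>2" if "w a < r\<^sup>2" for a
  proof -
    have "sum w (T \<union> (C \<inter> small) \<union> {a}) \<le> sum w (T \<union> (C \<inter> small)) + sum w {a}"
      using fT assms(1) w_pos[of a] by (cases "a \<in> T \<union> (C \<inter> small)") (auto simp: insert_absorb)
    then show ?thesis using that B1 by simp
  qed
  then show ?thesis using D B1 by (auto simp: add_increasing2 less_imp_le)
qed

end

section \<open>The invariant while no good packing exists\<close>

text \<open>The last three fields speak of all arrived items, discarded ones included; they are what
  bounds the optimum. In \<open>light_pair\<close> the partner \<open>m\<close> may differ from
  \<open>y\<close>: asking only for some kept medium item makes the field stable when
  \<open>m\<close> gives way to a smaller item.\<close>

locale buffer_state = buffer_sizes +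
  fixes n :: nat and B :: "nat set"
  assumes B_sub: "B \<subseteq> {..<n}"
    and no_good_B: "no_good B"
    and less_r: "\<And>j. j < n \<Longrightarrow> w j < r"
    and small_kept: "\<And>j. j < n \<Longrightarrow> j \<in> small \<Longrightarrow> j \<in> B"
    and cover_kept: "B \<noteq> {..<n} \<Longrightarrow> \<exists>T\<subseteq>B. min_cover {..<n} T"
    and least_kept: "\<And>j. j < n \<Longrightarrow> j \<in> med \<Longrightarrow> \<exists>m\<in>B \<inter> med. w m \<le> w j"
    and light_pair: "\<And>x y. \<lbrakk>x < n; y < n; x \<noteq> y; x \<in> med; y \<in> med; w x < r\<^sup>2; w y < r\<^sup>2\<rbrakk>
      \<Longrightarrow> \<exists>m\<in>B \<inter> med. w x + w m \<le> r"
    and heavy_pair: "\<And>x y. \<lbrakk>x < n; y < n; x \<noteq> y; x \<in> med; y \<in> med; r\<^sup>2 \<le> w x\<rbrakk> \<Longrightarrow> 1 < w x + w y"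
    and triple: "\<And>P. P \<subseteq> {..<n} \<inter> med \<Longrightarrow> card P = 3 \<Longrightarrow> 1 < sum w P"

text \<open>With nothing discarded, every field follows from the lack of a good packing: two medium
  items below r^2 fit since 2r^2 <= 1, hence stay below \<open>r\<close>; a pair with an item of
  size at least r^2 and a medium triple reach \<open>r\<close>, hence exceed 1.\<close>

lemma (in buffer_sizes) buffer_state_full:
  assumes "no_good {..<n}" "\<And>j. j < n \<Longrightarrow> w j \<le> 1"
  shows "buffer_state r w n {..<n}"
proof
  have pair: "w x + w y < r" if "x < n" "y < n" "x \<noteq> y" "w x + w y \<le> 1" for x y
    using no_goodD[OF assms(1), of "{x, y}"] that by auto
  show "w j < r" if "j < n" for j
    using no_goodD[OF assms(1), of "{j}"] that assms(2) by auto
  show "\<exists>m\<in>{..<n} \<inter> med. w x + w m \<le> r"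
    if "x < n" "y < n" "x \<noteq> y" "x \<in> med" "y \<in> med" "w x < r\<^sup>2" "w y < r\<^sup>2" for x y
    using pair[of x y] that r_square by force
  show "1 < w x + w y"
    if "x < n" "y < n" "x \<noteq> y" "x \<in> med" "y \<in> med" "r\<^sup>2 \<le> w x" for x y
    using pair[of x y] that cover_plus_medium by (force simp: med_def)
  show "1 < sum w P" if "P \<subseteq> {..<n} \<inter> med" "card P = 3" for P
    using no_good_big[OF assms(1), of P] sum_med_ge[of P] that r_le finite_subset[of P "{..<n}"]
    by auto
qed (use assms in auto)

context buffer_state
begin

lemma finite_B: "finite B"
  using finite_subset[OF B_sub] by simp

text \<open>Lets a kept cover stand in for discarded medium items: if these total at least r^2, a
  minimal cover is no larger than they are, so they do not fit beside \<open>n\<close>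
  either.\<close>

lemma cover_arrival:
  assumes "no_good (insert n B)" "T \<subseteq> B" "min_cover N T" "n \<in> med"
  shows "1 < sum w T + w n"
proof -
  have "n \<notin> T" "finite T" using assms B_sub finite_B finite_subset by auto
  then have "sum w (insert n T) = sum w T + w n" by simp
  moreover have "r \<le> sum w T + w n"
    using assms(3,4) cover_plus_medium by (simp add: min_cover_def med_def)
  ultimately show ?thesis
    using no_good_big[OF assms(1), of "insert n T"] assms(2) by auto
qed

text \<open>Had an item ever been discarded, a kept cover would give the buffer medium size at least
  r^2. So on this branch everything is still present.\<close>

lemma buffer_state_keep:
  assumes "no_good (insert n B)" "sum w (insert n B \<inter> med) < r\<^sup>2" "w n \<le> 1"
  shows "buffer_state r w (Suc n) (insert n B)"
proof -
  have "B = {..<n}"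
  proof (rule ccontr)
    assume "B \<noteq> {..<n}"
    then obtain T where T: "T \<subseteq> B" "min_cover {..<n} T" using cover_kept by blast
    then have "sum w T \<le> sum w (insert n B \<inter> med)"
      using finite_B by (intro sum_w_mono) (auto simp: min_cover_def)
    then show False using T assms(2) by (auto simp: min_cover_def)
  qed
  then have "insert n B = {..<Suc n}" by auto
  moreover have "w j \<le> 1" if "j < Suc n" for j
    using that less_r[of j] assms(3) r_le by (cases "j = n") auto
  ultimately show ?thesis using buffer_state_full[of "Suc n"] assms(1) by simp
qed

text \<open>Each claim about a discarded item is reduced to kept ones, through a kept medium item
  that is no larger or through the old minimal cover.\<close>

lemma buffer_state_compress:
  assumes ng: "no_good (insert n B)" and D: "compress (insert n B) D" and "w n \<le> 1"
  shows "buffer_state r w (Suc n) D"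
proof -
  let ?C = "insert n B"
  obtain T where T: "T \<subseteq> ?C" "min_cover ?C T"
    and rest: "D = ?C \<and> ?C = T \<union> (?C \<inter> small) \<or>
      (\<exists>a. is_arg_min w (\<lambda>j. j \<in> ?C - (T \<union> (?C \<inter> small))) a \<and>
         D = T \<union> (?C \<inter> small) \<union> (if w a < r\<^sup>2 then {a} else {}))"
    using D unfolding compress_def by blast
  have TD: "T \<subseteq> D" and smallD: "?C \<inter> small \<subseteq> D" using rest by auto
  have DC: "D \<subseteq> ?C" using rest T(1) by (auto simp: is_arg_min_def split: if_splits)
  have Tmin: "sum w T \<le> sum w P" if "P \<subseteq> ?C \<inter> med" "r\<^sup>2 \<le> sum w P" for P
    using T(2) that by (auto simp: min_cover_def)
  have T': "T \<subseteq> med" "r\<^sup>2 \<le> sum w T" using T(2) by (auto simp: min_cover_def)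
  have finT: "finite T" using T(1) finite_B finite_subset by blast
  have n_notin: "n \<notin> B" using B_sub by auto
  have new_less: "w j < r" if "j < Suc n" for j
    using that less_r[of j] no_goodD[OF ng, of "{n}"] assms(3) by (cases "j = n") auto
  have new_pair: "w x + w n < r" if "x \<in> B" "w x + w n \<le> 1" for x
  proof -
    have "x \<noteq> n" using that n_notin by auto
    then show ?thesis using no_goodD[OF ng, of "{x, n}"] that by auto
  qed
  \<comment> \<open>A smallest medium item survives. If the candidate \<open>a\<close> is too big to
    be retained, then \<open>c\<close> alone is a cover, so every member of \<open>T\<close> is at
    most \<open>w c\<close>.\<close>
  have least_D: "\<exists>m\<in>D \<inter> med. w m \<le> w c" if c: "c \<in> ?C" "c \<in> med" for c
  proof (cases "c \<in> D")
    case False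
    then obtain a where a: "is_arg_min w (\<lambda>j. j \<in> ?C - (T \<union> (?C \<inter> small))) a"
      and Da: "D = T \<union> (?C \<inter> small) \<union> (if w a < r\<^sup>2 then {a} else {})"
      using rest c by auto
    have "c \<in> ?C - (T \<union> (?C \<inter> small))" using False c TD smallD by auto
    then have ac: "w a \<le> w c" using a by (force simp: is_arg_min_linorder)
    have "a \<in> ?C" "a \<notin> small" using a by (auto simp: is_arg_min_def)
    then have am: "a \<in> med" using ac c by (auto simp: small_def med_def)
    show ?thesis
    proof (cases "w a < r\<^sup>2")
      case True
      then show ?thesis using Da am ac by auto
    next
      case False
      then have "sum w T \<le> w c" using Tmin[of "{c}"] c ac by auto
      moreover have "T \<noteq> {}" using T' r_ge by auto
      then obtain t where "t \<in> T" by auto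
      ultimately have "w t \<le> w c" "t \<in> D \<inter> med"
        using w_le_sum[OF finT, of t] TD T'(1) by auto
      then show ?thesis by blast
    qed
  qed (use c in auto)
  have least_D': "\<exists>m\<in>D \<inter> med. w m \<le> b" if "c \<in> ?C" "c \<in> med" "w c \<le> b" for b c
    using least_D[OF that(1,2)] that(3) order_trans by blast
  \<comment> \<open>Since r <= 3/4, two sizes above 1 - r exceed 1/2, which is at least r^2.\<close>
  have two_med: "r\<^sup>2 \<le> w x + w y" if "x \<in> med" "y \<in> med" for x y
    using that r_le r_square by (auto simp: med_def)
  have cover: "min_cover {..<Suc n} T"
    unfolding min_cover_def
  proof (intro conjI allI impI)
    fix P assume P: "P \<subseteq> {..<Suc n} \<inter> med" "r\<^sup>2 \<le> sum w P"
    have finP: "finite P" using P finite_subset by blast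
    show "sum w T \<le> sum w P"
    proof (cases "P \<subseteq> ?C")
      case False
      then obtain x where x: "x \<in> P" "x \<notin> B" "x \<noteq> n" by auto
      then have xn: "x < n" "x \<in> med" using P by force+
      show ?thesis
      proof (cases "n \<in> P")
        case True
        obtain m where m: "m \<in> B \<inter> med" "w m \<le> w x" using least_kept xn by blast
        have mn: "m \<noteq> n" using m n_notin by auto
        \<comment> \<open>\<open>P\<close> has a discarded member \<open>x\<close>; compare instead
          with the new item and a kept medium item no larger than \<open>x\<close>.\<close>
        have "sum w T \<le> sum w {m, n}"
        proof (rule Tmin)
          have "n \<in> med" using P(1) True by auto
          then show "{m, n} \<subseteq> ?C \<inter> med" "r\<^sup>2 \<le> sum w {m, n}"
            using two_med[of m n] m mn by auto
        qed
        also have "\<dots> = w m + w n" using mn by simp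
        finally show ?thesis
          using pair_le_sum[OF finP x(1) True x(3)] m by linarith
      next
        case False
        then have Pn: "P \<subseteq> {..<n} \<inter> med" using P by (force simp: less_Suc_eq)
        \<comment> \<open>All of \<open>P\<close> arrived earlier, so the old cover, still available
          in this round, is squeezed between \<open>T\<close> and \<open>P\<close>.\<close>
        have "B \<noteq> {..<n}" using x xn by auto
        then obtain U where "U \<subseteq> B" "min_cover {..<n} U" using cover_kept by blast
        then have "sum w T \<le> sum w U" "sum w U \<le> sum w P"
          using Tmin[of U] Pn P by (auto simp: min_cover_def)
        then show ?thesis by simp
      qed
    qed (use Tmin P in auto)
  qed (use T' in auto)
  show ?thesis
  proof
    show "D \<subseteq> {..<Suc n}" using DC B_sub by (auto intro: less_SucI)
    show "no_good D" using no_good_mono ng DC by blast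
    show "w j < r" if "j < Suc n" for j using new_less that .
    show "j \<in> D" if "j < Suc n" "j \<in> small" for j
      using smallD that small_kept by (auto simp: less_Suc_eq)
    show "\<exists>T\<subseteq>D. min_cover {..<Suc n} T" using cover TD by blast
    show "\<exists>m\<in>D \<inter> med. w m \<le> w j" if j: "j < Suc n" "j \<in> med" for j
    proof -
      obtain c where "c \<in> ?C" "c \<in> med" "w c \<le> w j"
        using j least_kept[of j] by (auto simp: less_Suc_eq)
      then show ?thesis by (rule least_D')
    qed
    show "\<exists>m\<in>D \<inter> med. w x + w m \<le> r"
      if xy: "x < Suc n" "y < Suc n" "x \<noteq> y" "x \<in> med" "y \<in> med" "w x < r\<^sup>2" "w y < r\<^sup>2" for x y
    proof -
      \<comment> \<open>A partner among the available items is enough, as \<open>least_D'\<close>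
        exchanges it for one in \<open>D\<close>.\<close>
      have "\<exists>c\<in>?C \<inter> med. w x + w c \<le> r"
      proof (cases "x < n")
        case x: True
        show ?thesis
        proof (cases "y < n")
          case True
          then show ?thesis using light_pair[of x y] x xy by blast
        next
          case False
          then have y: "y = n" using xy by simp
          show ?thesis
          proof (cases "x \<in> B")
            case True
            then show ?thesis using new_pair[of x] y xy r_square by force
          next
            case False
            \<comment> \<open>With \<open>x\<close> discarded, nothing is known about
              \<open>x\<close> beside \<open>n\<close>. But \<open>m\<close> is a second medium item
              below r^2, so the old invariant applies to \<open>x\<close> and
              \<open>m\<close>.\<close>
            obtain m where m: "m \<in> B \<inter> med" "w m \<le> w x" using least_kept x xy by blast
            then have "m \<noteq> x" "m < n" using False B_sub by auto
            then show ?thesis using light_pair[of x m] x xy m by force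
          qed
        qed
      next
        case False
        then have x: "x = n" "y < n" using xy by auto
        obtain m where m: "m \<in> B \<inter> med" "w m \<le> w y" using least_kept x xy by blast
        then show ?thesis using new_pair[of m] x xy r_square by force
      qed
      then obtain c where "c \<in> ?C" "c \<in> med" "w c \<le> r - w x" by (auto simp: algebra_simps)
      then have "\<exists>m\<in>D \<inter> med. w m \<le> r - w x" by (rule least_D')
      then show ?thesis by (simp add: algebra_simps)
    qed
    show "1 < w x + w y"
      if xy: "x < Suc n" "y < Suc n" "x \<noteq> y" "x \<in> med" "y \<in> med" "r\<^sup>2 \<le> w x" for x y
    proof -
      consider "x < n" "y < n" | "x < n" "y = n" | "x = n" "y < n" using xy by linarith
      then show ?thesis
      proof cases
        case 1
        then show ?thesis using heavy_pair xy by blast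
      next
        case 2
        show ?thesis
        proof (cases "x \<in> B")
          case True
          then show ?thesis
            using new_pair[of x] 2 xy cover_plus_medium by (force simp: med_def)
        next
          case False
          \<comment> \<open>The discarded \<open>x\<close> is a cover by itself, so a kept cover is
            no larger and already overfills the knapsack with \<open>n\<close>.\<close>
          then obtain U where U: "U \<subseteq> B" "min_cover {..<n} U" using cover_kept 2 by blast
          moreover have "{x} \<subseteq> {..<n} \<inter> med" "r\<^sup>2 \<le> sum w {x}" using 2 xy by auto
          ultimately have "sum w U \<le> sum w {x}" unfolding min_cover_def by blast
          then show ?thesis using cover_arrival[OF ng U] 2 xy by simp
        qed
      next
        case 3
        obtain m where m: "m \<in> B \<inter> med" "w m \<le> w y" using least_kept 3 xy by blast
        then show ?thesis
          using new_pair[of m] 3 xy cover_plus_medium by (force simp: med_def)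
      qed
    qed
    show "1 < sum w P" if P: "P \<subseteq> {..<Suc n} \<inter> med" "card P = 3" for P
    proof (cases "n \<in> P")
      case False
      then have "P \<subseteq> {..<n} \<inter> med" using P by (force simp: less_Suc_eq)
      then show ?thesis using triple P by blast
    next
      case True
      have finP: "finite P" using P finite_subset by blast
      have split: "sum w P = w n + sum w (P - {n})" using True finP by (simp add: sum.remove)
      show ?thesis
      proof (cases "P \<subseteq> ?C")
        case True
        then show ?thesis
          using no_good_big[OF ng True] sum_med_ge[of P] P finP r_le by auto
      next
        case False
        have Pn: "P - {n} \<subseteq> {..<n} \<inter> med" using P by (force simp: less_Suc_eq)
        \<comment> \<open>The two members besides \<open>n\<close> total at least r^2, so a kept
          cover can take their place.\<close>
        have "card (P - {n}) = 2" using P True finP by simp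
        then have "r\<^sup>2 \<le> sum w (P - {n})"
          using sum_med_ge[of "P - {n}"] Pn finP r_le r_square by auto
        moreover have "B \<noteq> {..<n}" using False Pn by auto
        then obtain U where U: "U \<subseteq> B" "min_cover {..<n} U" using cover_kept by blast
        ultimately have "sum w U \<le> sum w (P - {n})" using Pn by (auto simp: min_cover_def)
        then show ?thesis using cover_arrival[OF ng U] split P True by auto
      qed
    qed
  qed
qed

section \<open>The ratio guaranteed by the invariant\<close>

text \<open>With p the smallest kept medium size, the pair is at most 2(r - p). A one-element cover
  has size above 1 - p, a larger one at least 2p, and both bounds are at least 2r(r - p).\<close>

lemma light_pair_bound:
  assumes T: "T \<subseteq> B" "min_cover {..<n} T"
    and x: "x < n" "x \<in> med" and y: "y < n" "y \<in> med" and "x \<noteq> y" "w x + w y \<le> 1"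
  shows "r * (w x + w y) \<le> sum w T"
proof -
  have light: "w x < r\<^sup>2" "w y < r\<^sup>2"
    using heavy_pair[of x y] heavy_pair[of y x] assms by force+
  have finT: "finite T" using T finite_B finite_subset by blast
  have Tm: "T \<subseteq> med" "r\<^sup>2 \<le> sum w T" using T by (auto simp: min_cover_def)
  have "B \<inter> med \<noteq> {}" using least_kept x by blast
  then obtain p where p: "p \<in> B \<inter> med" and p_le: "\<And>j. j \<in> B \<inter> med \<Longrightarrow> w p \<le> w j"
    using finite_B ex_min_if_finite[of "w ` (B \<inter> med)"] by (force simp: not_less)
  have "w x + w p \<le> r" "w y + w p \<le> r"
    using light_pair[of x y] light_pair[of y x] p_le light assms by force+
  then have "w x + w y \<le> 2 * (r - w p)" by simp
  then have "r * (w x + w y) \<le> r * (2 * (r - w p))" using r_ge by (intro mult_left_mono) auto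
  also have "\<dots> \<le> sum w T"
  proof -
    obtain t where t: "t \<in> T" using Tm r_ge by fastforce
    have pm: "1 - r < w p" using p by (simp add: med_def)
    show ?thesis
    proof (cases "T = {t}")
      case True
      \<comment> \<open>A cover that is the single item \<open>t\<close> has size at least r^2, so
        \<open>p\<close> is a different item; together they reach \<open>r\<close> and hence exceed
        1.\<close>
      have "w p < r\<^sup>2" using p_le least_kept[OF x] light by force
      then have "p \<noteq> t" using True Tm by auto
      then have "1 < w p + w t"
        using no_good_big[OF no_good_B, of "{p, t}"] p True T Tm pm cover_plus_medium by auto
      moreover have "r * (2 * (r - w p)) \<le> 1 - w p"
      proof -
        \<comment> \<open>The inequality to show has slack (1 - 2r^2) + p(2r - 1), where p is
          \<open>w p\<close>.\<close>
        have "0 \<le> w p * (2 * r - 1)" using w_pos[of p] r_ge by (intro mult_nonneg_nonneg) auto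
        then show ?thesis using r_square by (simp add: power2_eq_square algebra_simps)
      qed
      ultimately show ?thesis using True by simp
    next
      case False
      then obtain u where "u \<in> T" "u \<noteq> t" using t by auto
      then have "2 * w p \<le> sum w T"
        using pair_le_sum[OF finT t, of u] p_le[of t] p_le[of u] t T(1) Tm(1) by force
      \<comment> \<open>The left side is 1 - r^2, which is at least r^2; so r^2 <= (1 + r) p with p
        for \<open>w p\<close>, the claim rearranged.\<close>
      moreover have "(1 + r) * (1 - r) \<le> (1 + r) * w p"
        using pm r_ge by (intro mult_left_mono) auto
      then have "r * (2 * (r - w p)) \<le> 2 * w p"
        using r_square by (simp add: power2_eq_square algebra_simps)
      ultimately show ?thesis by simp
    qed
  qed
  finally show ?thesis .
qed

text \<open>If something was discarded, match the medium part of \<open>P\<close> with a minimal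
  cover and its small part with the small items, all of which are kept. At most two medium items
  fit: one is below \<open>r\<close>, so \<open>r\<close> times its size is below r^2; two are the
  case of \<open>light_pair_bound\<close>.\<close>

lemma packing_ratio:
  assumes P: "P \<subseteq> {..<n}" "sum w P \<le> 1"
  shows "\<exists>Q\<subseteq>B. sum w Q \<le> 1 \<and> r * sum w P \<le> sum w Q"
proof (cases "B = {..<n}")
  case True
  have "0 \<le> sum w P" using w_pos by (intro sum_nonneg) (auto intro: less_imp_le)
  then have "r * sum w P \<le> sum w P" using r_le by (intro mult_left_le_one_le) (use r_ge in auto)
  then show ?thesis using True P by blast
next
  case False
  then obtain T where T: "T \<subseteq> B" "min_cover {..<n} T" using cover_kept by blast
  have finP: "finite P" using P finite_subset by blast
  have finT: "finite T" using T finite_B finite_subset by blast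
  have Tm: "T \<subseteq> med" "r\<^sup>2 \<le> sum w T" using T by (auto simp: min_cover_def)
  have disj: "med \<inter> small = {}" by (auto simp: med_def small_def)
  have "P = (P \<inter> med) \<union> (P \<inter> small)"
    using P less_r by (force simp: med_def small_def)
  then have split: "sum w P = sum w (P \<inter> med) + sum w (P \<inter> small)"
    using finP disj by (metis (no_types, lifting) finite_Int inf_assoc inf_left_commute
        inf_bot_right sum.union_disjoint)
  have "sum w T \<le> 1" using min_cover_le_1[OF finT T(2)] T(1) B_sub by blast
  then have le1: "sum w (T \<union> (B \<inter> small)) \<le> 1"
    using sum_with_small_less[OF finite_B no_good_B T(1)] r_le by simp
  have union: "sum w (T \<union> (B \<inter> small)) = sum w T + sum w (B \<inter> small)"
    using finT finite_B Tm disj by (intro sum.union_disjoint) auto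
  have small0: "0 \<le> sum w (P \<inter> small)" using w_pos by (intro sum_nonneg) (auto intro: less_imp_le)
  then have "r * sum w (P \<inter> small) \<le> sum w (P \<inter> small)"
    using r_le r_ge by (intro mult_left_le_one_le) auto
  also have "\<dots> \<le> sum w (B \<inter> small)"
    using P small_kept finite_B by (intro sum_w_mono) auto
  finally have small: "r * sum w (P \<inter> small) \<le> sum w (B \<inter> small)" .
  have "r * sum w (P \<inter> med) \<le> sum w T"
  proof -
    have "card (P \<inter> med) < 3"
    proof (rule ccontr)
      assume "\<not> card (P \<inter> med) < 3"
      then obtain U where U: "U \<subseteq> P \<inter> med" "card U = 3"
        using obtain_subset_with_card_n[of 3 "P \<inter> med"] by force
      then have "1 < sum w U" using triple[of U] P by auto
      moreover have "sum w U \<le> sum w P" using U finP by (intro sum_w_mono) auto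
      ultimately show False using P by simp
    qed
    then consider "card (P \<inter> med) = 0" | "card (P \<inter> med) = 1" | "card (P \<inter> med) = 2" by linarith
    then show ?thesis
    proof cases
      case 1
      then have "P \<inter> med = {}" using finP by simp
      then show ?thesis using order_trans[OF zero_le_power2 Tm(2)] by simp
    next
      case 2
      then obtain x where x: "P \<inter> med = {x}" using card_1_singletonE by blast
      then have "w x < r" by (auto simp: med_def)
      then have "r * w x \<le> r * r" using r_ge by (intro mult_left_mono) auto
      then show ?thesis using x Tm by (simp add: power2_eq_square)
    next
      case 3
      then obtain x y where xy: "P \<inter> med = {x, y}" "x \<noteq> y" by (auto simp: card_2_iff)
      then have "w x + w y \<le> 1" using split small0 P by simp
      moreover have "x < n" "y < n" "x \<in> med" "y \<in> med" using xy P by auto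
      ultimately show ?thesis using light_pair_bound[OF T, of x y] xy by simp
    qed
  qed
  then have "r * sum w P \<le> sum w (T \<union> (B \<inter> small))"
    using split union small by (simp add: distrib_left)
  then show ?thesis using le1 T(1) by (intro exI[of _ "T \<union> (B \<inter> small)"]) auto
qed

end

section \<open>Input lists and optimal values\<close>

text \<open>The value 1 beyond the end of the input makes every size positive, as the locale demands.\<close>

definition sizes :: "item list \<Rightarrow> nat \<Rightarrow> real" where
  "sizes I j = (if j < length I then isize (I ! j) else 1)"

lemma sizes_bounds: "I \<in> proportional_inputs \<Longrightarrow> 0 < sizes I j \<and> sizes I j \<le> 1"
  by (auto simp: sizes_def proportional_inputs_def knapsack_inputs_def)

text \<open>Lets every round be measured by the one function \<open>sizes I\<close> of the whole
  input, so that the invariant can be carried from round to round.\<close>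

lemma total_take:
  "k \<le> length I \<Longrightarrow> B \<subseteq> {..<k} \<Longrightarrow> total isize (take k I) B = sum (sizes I) B"
  unfolding total_def sizes_def by (intro sum.cong) auto

lemma best_value_proportional:
  assumes "I \<in> proportional_inputs" "C \<subseteq> {..<length I}"
  shows "best_value I C = Max {sum (sizes I) B | B. B \<subseteq> C \<and> sum (sizes I) B \<le> 1}"
proof -
  have "total ivalue I B = sum (sizes I) B" "total isize I B = sum (sizes I) B" if "B \<subseteq> C" for B
    using assms that unfolding total_def sizes_def proportional_inputs_def
    by (auto intro!: sum.cong)
  then have "{total ivalue I B | B. B \<subseteq> C \<and> total isize I B \<le> 1} =
      {sum (sizes I) B | B. B \<subseteq> C \<and> sum (sizes I) B \<le> 1}"
    by (metis (no_types, lifting))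
  then show ?thesis by (simp add: best_value_def)
qed

lemma best_value_ge:
  assumes "I \<in> proportional_inputs" "C \<subseteq> {..<length I}" "B \<subseteq> C" "sum (sizes I) B \<le> 1"
  shows "sum (sizes I) B \<le> best_value I C"
proof -
  have "finite C" using assms finite_subset by blast
  then have "finite {sum (sizes I) B | B. B \<subseteq> C \<and> sum (sizes I) B \<le> 1}" by simp
  then show ?thesis
    unfolding best_value_proportional[OF assms(1,2)] using assms(3,4) by (intro Max_ge) auto
qed

lemma best_value_attained:
  assumes "I \<in> proportional_inputs" "C \<subseteq> {..<length I}"
  shows "\<exists>B\<subseteq>C. sum (sizes I) B \<le> 1 \<and> best_value I C = sum (sizes I) B"
proof -
  let ?V = "{sum (sizes I) B | B. B \<subseteq> C \<and> sum (sizes I) B \<le> 1}"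
  have "finite C" using assms finite_subset by blast
  then have "finite ?V" by simp
  moreover have "sum (sizes I) {} \<in> ?V" by force
  ultimately have "Max ?V \<in> ?V" by (intro Max_in) auto
  then show ?thesis using best_value_proportional[OF assms] by auto
qed

section \<open>The branches of a single round\<close>

text \<open>Flattens the nested conditionals; the last case joins the subcases with and without a
  leftover item in the form that \<open>compress\<close> has.\<close>

lemma buffer_roundE:
  assumes "buffer_round r I C B"
  obtains (good) "good_packing r I C B"
  | (keep) "\<nexists>P. good_packing r I C P" "total isize I (C \<inter> medium_items r I) < r\<^sup>2" "B = C"
  | (compress) T where "\<nexists>P. good_packing r I C P"
      "is_arg_min (total isize I)
         (\<lambda>P. P \<subseteq> C \<inter> medium_items r I \<and> r\<^sup>2 \<le> total isize I P) T"
      "B = C \<and> C = T \<union> (C \<inter> small_items r I) \<or>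
       (\<exists>a. is_arg_min (\<lambda>j. isize (I ! j)) (\<lambda>j. j \<in> C - (T \<union> (C \<inter> small_items r I))) a \<and>
          B = T \<union> (C \<inter> small_items r I) \<union>
            (if a \<in> medium1_items r I \<union> medium2_items r I then {a} else {}))"
proof -
  obtain B1 B2 where B: "B = B1 \<union> B2"
    and branch: "if \<exists>P. good_packing r I C P then good_packing r I C B1 \<and> B2 = {}
      else if r\<^sup>2 \<le> total isize I (C \<inter> medium_items r I) then
        (\<exists>T. is_arg_min (total isize I)
               (\<lambda>P. P \<subseteq> C \<inter> medium_items r I \<and> r\<^sup>2 \<le> total isize I P) T \<and>
             B1 = T \<union> (C \<inter> small_items r I)) \<and>
        (if B1 \<noteq> C then
           (\<exists>a. is_arg_min (\<lambda>j. isize (I ! j)) (\<lambda>j. j \<in> C - B1) a \<and>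
                B2 = (if a \<in> medium1_items r I \<union> medium2_items r I then {a} else {}))
         else B2 = {})
      else B1 = C \<and> B2 = {}"
    using assms unfolding buffer_round_def by blast
  show thesis
  proof (cases "\<exists>P. good_packing r I C P")
    case True
    then show thesis using good B branch unfolding if_P[OF True] by simp
  next
    case ng: False
    show thesis
    proof (cases "r\<^sup>2 \<le> total isize I (C \<inter> medium_items r I)")
      case True
      have branch': "\<exists>T. is_arg_min (total isize I)
               (\<lambda>P. P \<subseteq> C \<inter> medium_items r I \<and> r\<^sup>2 \<le> total isize I P) T \<and>
             B1 = T \<union> (C \<inter> small_items r I)"
        "if B1 \<noteq> C then
           (\<exists>a. is_arg_min (\<lambda>j. isize (I ! j)) (\<lambda>j. j \<in> C - B1) a \<and>
                B2 = (if a \<in> medium1_items r I \<union> medium2_items r I then {a} else {}))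
         else B2 = {}"
        using branch unfolding if_not_P[OF ng] if_P[OF True] by (rule conjunct1, rule conjunct2)
      then obtain T where T: "is_arg_min (total isize I)
               (\<lambda>P. P \<subseteq> C \<inter> medium_items r I \<and> r\<^sup>2 \<le> total isize I P) T"
        and B1: "B1 = T \<union> (C \<inter> small_items r I)" by blast
      show thesis
      proof (cases "B1 = C")
        case True
        then show thesis using compress[OF ng T] branch'(2) B B1 by simp
      next
        case False
        obtain a where "is_arg_min (\<lambda>j. isize (I ! j)) (\<lambda>j. j \<in> C - B1) a"
          "B2 = (if a \<in> medium1_items r I \<union> medium2_items r I then {a} else {})"
          using branch'(2) unfolding if_P[OF False] by blast
        then show thesis using compress[OF ng T] unfolding B B1 by blast
      qed
    next
      case False
      then show thesis using keep[OF ng] branch B unfolding if_not_P[OF ng] if_not_P[OF False]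
        by simp
    qed
  qed
qed

lemma buffer_round_subset:
  assumes "buffer_round r I C B"
  shows "B \<subseteq> C"
  using assms
proof (cases rule: buffer_roundE)
  case (compress T)
  have "T \<subseteq> C" using compress(2) by (simp add: is_arg_min_def)
  then show ?thesis using compress(3) by (auto simp: is_arg_min_def split: if_split_asm)
qed (auto simp: good_packing_def)

text \<open>The minima range over finite sets of candidates, nonempty on the branch that asks for
  them, so a round never gets stuck.\<close>

lemma buffer_round_exists:
  assumes "finite C"
  shows "\<exists>B. buffer_round r I C B"
proof -
  let ?Q = "\<lambda>P. P \<subseteq> C \<inter> medium_items r I \<and> r\<^sup>2 \<le> total isize I P"
  have arg_T: "\<exists>T. is_arg_min (total isize I) ?Q T"
    if cover: "r\<^sup>2 \<le> total isize I (C \<inter> medium_items r I)"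
  proof -
    have "finite {P. ?Q P}" by (rule finite_subset[of _ "Pow C"]) (use assms in auto)
    moreover have "C \<inter> medium_items r I \<in> {P. ?Q P}" using cover by simp
    then have "{P. ?Q P} \<noteq> {}" by blast
    ultimately show ?thesis
      using ex_is_arg_min_if_finite[of "{P. ?Q P}" "total isize I"] by simp
  qed
  have arg_a: "\<exists>a. is_arg_min (\<lambda>j. isize (I ! j)) (\<lambda>j. j \<in> C - B) a" if "B \<noteq> C" "B \<subseteq> C" for B
    using that assms by (intro ex_is_arg_min_if_finite) blast+
  show ?thesis
  proof (cases "\<exists>P. good_packing r I C P")
    case True
    then show ?thesis unfolding buffer_round_def if_P[OF True] by blast
  next
    case no_good: False
    show ?thesis
    proof (cases "r\<^sup>2 \<le> total isize I (C \<inter> medium_items r I)")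
      case True
      then obtain T where T: "is_arg_min (total isize I) ?Q T" using arg_T by blast
      let ?B = "T \<union> (C \<inter> small_items r I)"
      have "?B \<subseteq> C" using T by (auto simp: is_arg_min_def)
      then have "\<exists>B2. if ?B \<noteq> C then
          (\<exists>a. is_arg_min (\<lambda>j. isize (I ! j)) (\<lambda>j. j \<in> C - ?B) a \<and>
            B2 = (if a \<in> medium1_items r I \<union> medium2_items r I then {a} else {}))
        else B2 = {}"
        using arg_a[of ?B] by (cases "?B = C") (simp, metis)
      then show ?thesis
        using T unfolding buffer_round_def if_not_P[OF no_good] if_P[OF True] by blast
    next
      case False
      then show ?thesis
        unfolding buffer_round_def if_not_P[OF no_good] if_not_P[OF False] by blast
    qed
  qed
qed

section \<open>Existence of an instance of the algorithm\<close>

text \<open>The history is given newest item first, so that primitive recursion strips the last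
  arrival; \<open>SOME\<close> breaks the ties.\<close>

primrec first_buffer :: "real \<Rightarrow> item list \<Rightarrow> nat set" where
  "first_buffer r [] = {}"
| "first_buffer r (e # J) =
     (SOME B. buffer_round r (rev (e # J)) (first_buffer r J \<union> {length J}) B)"

text \<open>Keeps the claim about all instances from being vacuous. Finiteness of the buffers is
  carried along the history to make each choice possible.\<close>

lemma buffer_algorithm_exists: "\<exists>A. buffer_algorithm R A"
proof -
  let ?r = "threshold R"
  have round: "buffer_round ?r (rev (e # J)) (first_buffer ?r J \<union> {length J}) (first_buffer ?r (e # J))"
    if "finite (first_buffer ?r J)" for e J
    unfolding first_buffer.simps by (rule someI_ex, rule buffer_round_exists) (use that in simp)
  have fin: "finite (first_buffer ?r J)" for J
  proof (induction J)
    case (Cons e J)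
    show ?case
      using finite_subset[OF buffer_round_subset[OF round[OF Cons, of e]]] Cons by blast
  qed simp
  have "buffer_algorithm R (\<lambda>I. first_buffer ?r (rev I))"
    unfolding buffer_algorithm_def using round[OF fin, of _ "rev _"] by simp
  then show ?thesis by blast
qed

section \<open>Runs over a whole input\<close>

text \<open>Translates a round on a prefix of the input into the notions of the locale.\<close>

lemma buffer_round_cases:
  assumes I: "I \<in> proportional_inputs" and k: "k < length I" and C: "C \<subseteq> {..<Suc k}"
    and round: "buffer_round r (take (Suc k) I) C D"
    and sizes: "buffer_sizes r (sizes I)"
  obtains (good) "D \<subseteq> C" "r \<le> sum (sizes I) D" "sum (sizes I) D \<le> 1"
  | (keep) "buffer_sizes.no_good r (sizes I) C"
      "sum (sizes I) (C \<inter> buffer_sizes.med r (sizes I)) < r\<^sup>2" "D = C"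
  | (compress) "buffer_sizes.no_good r (sizes I) C" "buffer_sizes.compress r (sizes I) C D"
proof -
  interpret buffer_sizes r "sizes I" by fact
  let ?I = "take (Suc k) I"
  have tot: "total isize ?I B = sum (sizes I) B" if "B \<subseteq> C" for B
    using total_take[of "Suc k" I B] that C k by auto
  have size: "isize (?I ! j) = sizes I j" "j < length ?I" if "j \<in> C" for j
    using that C k by (auto simp: sizes_def)
  have med: "C \<inter> medium_items r ?I = C \<inter> med"
    using size by (auto simp: medium_items_def med_def)
  have small: "C \<inter> small_items r ?I = C \<inter> small"
    using size by (auto simp: small_items_def small_def)
  have ng: "no_good C" if "\<nexists>P. good_packing r ?I C P"
    using that tot by (auto simp: no_good_def good_packing_def not_le[symmetric])
  show thesis
    using round
  proof (cases rule: buffer_roundE)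
    case 1: good
    then show thesis using good tot by (auto simp: good_packing_def)
  next
    case 2: keep
    then show thesis using keep ng tot[of "C \<inter> med"] med by simp
  next
    case 3: (compress T)
    have TC: "T \<subseteq> C \<inter> med" using 3(2) med by (simp add: is_arg_min_def)
    have cover: "min_cover C T"
      using 3(2) TC tot unfolding med is_arg_min_linorder min_cover_def by (metis Int_subset_iff)
    have arg: "is_arg_min (sizes I) (\<lambda>j. j \<in> C - B) a \<and>
        (a \<in> medium1_items r ?I \<union> medium2_items r ?I \<longleftrightarrow> sizes I a < r\<^sup>2)"
      if "is_arg_min (\<lambda>j. isize (?I ! j)) (\<lambda>j. j \<in> C - B) a" "C \<inter> small \<subseteq> B" for a B
    proof
      show "is_arg_min (sizes I) (\<lambda>j. j \<in> C - B) a"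
        using that(1) by (auto simp: is_arg_min_linorder size(1) simp del: nth_take)
      have a: "a \<in> C" "a \<notin> small" using that by (auto simp: is_arg_min_def)
      \<comment> \<open>As \<open>a\<close> is not small, only the upper limits matter, and r/2 <
        r^2 puts M1 below r^2 as well.\<close>
      then show "a \<in> medium1_items r ?I \<union> medium2_items r ?I \<longleftrightarrow> sizes I a < r\<^sup>2"
        using size[OF a(1)] half_less_square
        by (auto simp: medium1_items_def medium2_items_def small_def)
    qed
    let ?B = "T \<union> (C \<inter> small)"
    have "D = C \<and> C = ?B \<or> (\<exists>a. is_arg_min (sizes I) (\<lambda>j. j \<in> C - ?B) a \<and>
        D = ?B \<union> (if sizes I a < r\<^sup>2 then {a} else {}))"
      using 3(3)[unfolded small]
    proof (elim disjE exE conjE)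
      fix a assume a: "is_arg_min (\<lambda>j. isize (?I ! j)) (\<lambda>j. j \<in> C - ?B) a"
        and D: "D = ?B \<union> (if a \<in> medium1_items r ?I \<union> medium2_items r ?I then {a} else {})"
      note arg = arg[OF a Un_upper2]
      show ?thesis using conjunct1[OF arg] D unfolding conjunct2[OF arg] by blast
    qed blast
    then have "compress C D"
      using TC cover unfolding compress_def by blast
    then show thesis using compress ng 3(1) by blast
  qed
qed

text \<open>A good packing in the old buffer is still available in the next round and forces the
  first branch again. If there is none among the available items, the old buffer satisfied the
  invariant, which the other two branches preserve.\<close>

lemma buffer_run:
  assumes A: "buffer_algorithm R A" and R: "threshold R = r" "R = r + r\<^sup>2"
    and r: "2 / 3 \<le> r" "2 * r\<^sup>2 \<le> 1" and I: "I \<in> proportional_inputs" and "k \<le> length I"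
  shows "A (take k I) \<subseteq> {..<k} \<and>
      ((\<exists>P\<subseteq>A (take k I). r \<le> sum (sizes I) P \<and> sum (sizes I) P \<le> 1) \<or>
       buffer_state r (sizes I) k (A (take k I))) \<and>
      sum (sizes I) (A (take k I)) \<le> R"
proof -
  interpret buffer_sizes r "sizes I"
    using r sizes_bounds[OF I] by unfold_locales auto
  have le1: "sizes I j \<le> 1" for j using sizes_bounds[OF I] by blast
  \<comment> \<open>2/3 + 4/9 = 10/9 exceeds 1, so a good packing fits into the buffer.\<close>
  have r_R: "1 \<le> R" "r \<le> R" using R r power_mono[of "2/3" r 2] by (auto simp: power2_eq_square)
  show ?thesis
    using \<open>k \<le> length I\<close>
  proof (induction k)
    case 0
    have "no_good {..<0}" using r by (simp add: no_good_def)
    then have "buffer_state r (sizes I) 0 {..<0}" by (rule buffer_state_full) simp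
    then show ?case using A r_R by (simp add: buffer_algorithm_def)
  next
    case (Suc k)
    let ?B = "A (take k I)" and ?D = "A (take (Suc k) I)"
    have k: "k < length I" using Suc.prems by simp
    have "set (take (Suc k) I) \<subseteq> set I" by (rule set_take_subset)
    then have "take k I @ [I ! k] \<in> proportional_inputs"
      using I k unfolding proportional_inputs_def knapsack_inputs_def
      by (auto simp: take_Suc_conv_app_nth)
    then have round: "buffer_round r (take (Suc k) I) (insert k ?B) ?D"
    proof -
      have app: "take (Suc k) I = take k I @ [I ! k]" using k by (rule take_Suc_conv_app_nth)
      have "buffer_round r (take k I @ [I ! k]) (?B \<union> {length (take k I)}) (A (take k I @ [I ! k]))"
        using A R(1) \<open>take k I @ [I ! k] \<in> _\<close> unfolding buffer_algorithm_def by blast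
      then show ?thesis using k by (simp add: app)
    qed
    have sub: "?D \<subseteq> insert k ?B" using buffer_round_subset[OF round] .
    have C: "insert k ?B \<subseteq> {..<Suc k}" using Suc by auto
    have fin: "finite (insert k ?B)" using finite_subset[OF C] by simp
    have state: "buffer_state r (sizes I) k ?B" if "no_good (insert k ?B)"
    proof -
      have "\<not> (\<exists>P\<subseteq>?B. r \<le> sum (sizes I) P \<and> sum (sizes I) P \<le> 1)"
      proof (intro notI, elim exE conjE)
        fix P assume "P \<subseteq> ?B" "r \<le> sum (sizes I) P" "sum (sizes I) P \<le> 1"
        then show False using no_goodD[OF that, of P] by (simp add: subset_insertI2)
      qed
      then show ?thesis using Suc.IH[OF less_imp_le[OF k]] by blast
    qed
    show ?case
      using I k C round buffer_sizes_axioms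
    proof (cases rule: buffer_round_cases)
      case good
      then show ?thesis using C r_R by auto
    next
      case keep
      interpret buffer_state r "sizes I" k ?B using state keep by blast
      have "buffer_state r (sizes I) (Suc k) ?D"
        using buffer_state_keep keep le1 by simp
      moreover have "sum (sizes I) ?D < r"
        using sum_keep_less[OF fin] keep le1 r by simp
      ultimately show ?thesis using sub C r_R by auto
    next
      case compress
      interpret buffer_state r "sizes I" k ?B using state compress by blast
      have "buffer_state r (sizes I) (Suc k) ?D"
        using buffer_state_compress compress le1 by simp
      moreover have "sum (sizes I) ?D \<le> R"
        using sum_compress_le[OF fin] compress R by simp
      ultimately show ?thesis using sub C by auto
    qed
  qed
qed

section \<open>The range of \<open>r\<close> and the ratio \<open>1 / r\<close>\<close>

theorem theorem12:
  fixes R :: real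
  assumes "10 / 9 \<le> R" and "R \<le> (1 + sqrt 2) / 2"
  shows "(\<exists>A. buffer_algorithm R A) \<and>
    (\<forall>A. buffer_algorithm R A \<longrightarrow>
       removable_online_algorithm proportional_inputs R A \<and>
       competitive proportional_inputs ((1 + sqrt (1 + 4 * R)) / (2 * R)) A)"
proof -
  define r where "r = threshold R"
  have sq: "(sqrt (1 + 4 * R))\<^sup>2 = 1 + 4 * R" using assms(1) by (intro real_sqrt_pow2) linarith
  have s_eq: "sqrt (1 + 4 * R) = 2 * r + 1" by (simp add: r_def threshold_def field_simps)
  have R: "R = r + r\<^sup>2" using sq unfolding s_eq by (simp add: power2_eq_square algebra_simps)
  \<comment> \<open>At R = 10/9 one has 1 + 4R = 49/9 = (7/3)^2, and 2r + 1 >= 7/3 means r >=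
    2/3.\<close>
  have "sqrt ((7 / 3)\<^sup>2) \<le> sqrt (1 + 4 * R)"
    using assms(1) by (intro real_sqrt_le_mono) (simp add: power2_eq_square)
  then have r_ge: "2 / 3 \<le> r" using s_eq by simp
  \<comment> \<open>Equality holds at the upper end of the range, where 1 + 4R = 3 + 2 sqrt
    2.\<close>
  have "1 + 4 * R \<le> (sqrt 2 + 1)\<^sup>2" using assms(2) by (simp add: power2_eq_square algebra_simps)
  then have "2 * r + 1 \<le> sqrt 2 + 1"
    using real_le_lsqrt[of "sqrt 2 + 1" "1 + 4 * R"] s_eq by simp
  then have "(2 * r)\<^sup>2 \<le> (sqrt 2)\<^sup>2" using r_ge by (intro power_mono) auto
  then have r_sq: "2 * r\<^sup>2 \<le> 1" by (simp add: power2_eq_square)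
  \<comment> \<open>The stated ratio in terms of \<open>r\<close>; the factor 2(1 + r)
    cancels.\<close>
  have "(1 + (2 * r + 1)) / (2 * (r + r\<^sup>2)) = (2 * (1 + r)) / (r * (2 * (1 + r)))"
    by (simp add: power2_eq_square algebra_simps)
  also have "\<dots> = 1 / r" using r_ge by simp
  finally have ratio: "(1 + sqrt (1 + 4 * R)) / (2 * R) = 1 / r"
    unfolding s_eq by (simp flip: R)
  have "removable_online_algorithm proportional_inputs R A \<and> competitive proportional_inputs (1 / r) A"
    if A: "buffer_algorithm R A" for A
  proof
    note run = buffer_run[OF A r_def[symmetric] R r_ge r_sq]
    show "removable_online_algorithm proportional_inputs R A"
      unfolding removable_online_algorithm_def
    proof (intro conjI allI impI)
      show "A [] = {}" using A by (simp add: buffer_algorithm_def)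
      fix I e assume I: "I @ [e] \<in> proportional_inputs"
      then show "A (I @ [e]) \<subseteq> A I \<union> {length I}"
        using A buffer_round_subset unfolding buffer_algorithm_def by blast
      show "total isize (I @ [e]) (A (I @ [e])) \<le> R"
        using run[OF I, of "Suc (length I)"] total_take[of "Suc (length I)" "I @ [e]"] by simp
    qed
    show "competitive proportional_inputs (1 / r) A"
      unfolding competitive_def
    proof
      fix I assume I: "I \<in> proportional_inputs"
      have sub: "A I \<subseteq> {..<length I}" using run[OF I, of "length I"] by simp
      obtain P where P: "P \<subseteq> {..<length I}" "sum (sizes I) P \<le> 1" "OPT I = sum (sizes I) P"
        using best_value_attained[OF I] unfolding OPT_def by blast
      have "\<exists>Q\<subseteq>A I. sum (sizes I) Q \<le> 1 \<and> r * sum (sizes I) P \<le> sum (sizes I) Q"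
      proof (cases "buffer_state r (sizes I) (length I) (A I)")
        case True
        then show ?thesis using buffer_state.packing_ratio[OF True P(1,2)] by blast
      next
        case False
        then obtain Q where Q: "Q \<subseteq> A I" "r \<le> sum (sizes I) Q" "sum (sizes I) Q \<le> 1"
          using run[OF I, of "length I"] by auto
        moreover have "r * sum (sizes I) P \<le> r * 1" using P r_ge by (intro mult_left_mono) auto
        ultimately have "r * sum (sizes I) P \<le> sum (sizes I) Q" by linarith
        then show ?thesis using Q by blast
      qed
      then obtain Q where Q: "Q \<subseteq> A I" "sum (sizes I) Q \<le> 1"
        "r * OPT I \<le> sum (sizes I) Q" unfolding P(3) by blast
      then have "r * OPT I \<le> ALG A I"
        using best_value_ge[OF I sub Q(1,2)] unfolding ALG_def by linarith
      then show "OPT I \<le> 1 / r * ALG A I" using r_ge by (simp add: field_simps)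
    qed
  qed
  then show ?thesis using buffer_algorithm_exists ratio by auto
qed

end
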